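(* Let $g(z)=z+\sum_{n\ge 2}g_nz^n\in\mathbb{A}$, write $[n]_g=g_n$, and let $\phi(z)=1+B_1z+B_2z^2+\cdots$ be as in the context. If $f(z)=z+\sum_{n\ge2}a_nz^n\in\mathbb{A}$ belongs to $\mathcal{S}^{\ast}_g(\phi)$, then $$|a_2|\le \frac{B_1}{[2]_g-1},\qquad |a_3|\le \frac{B_1}{[3]_g-1}\max\left\{1,\left|\frac{B_2}{B_1}+\frac{B_1}{[2]_g-1}\right|\right\}.$$
   Context: $\mathbb{U}=\{z\in\mathbb{C}:|z|<1\}$, and $\mathbb{A}$ is the set of analytic functions $f$ on $\mathbb{U}$ with $f(0)=0$, $f'(0)=1$, i.e. $f(z)=z+\sum_{n\ge2}a_nz^n$. For analytic $F,\phi$ on $\mathbb{U}$, $F\prec\phi$ (subordination) means there is an analytic $u$ on $\mathbb{U}$ with $u(0)=0$, $|u(z)|<1$ and $F(z)=\phi(u(z))$ for all $z\in\mathbb{U}$. For $g(z)=z+\sum_{n\ge2}g_nz^n\in\mathbb{A}$, the $g$-derivative of $f\in\mathbb{A}$ is $D_gf(z)=\frac1z\left(z+\sum_{n\ge2}[n]_ga_nz^n\right)$, where $[n]_g=g_n$ (so $zD_gf$ is the convolution, i.e. Hadamard product, of $f$ and $g$). The function $\phi$ is analytic on $\mathbb{U}$ with positive real part, $\phi(0)=1$, $\phi'(0)>0$, $\phi(\mathbb{U})$ symmetric with respect to the real axis, with expansion $\phi(z)=1+B_1z+B_2z^2+B_3z^3+\cdots$, $B_1>0$. The class $\mathcal{S}^{\ast}_g(\phi)$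 consists of all $f\in\mathbb{A}$ such that $\frac{zD_gf(z)}{f(z)}\prec\phi(z)$.
   Formalization: The formal statement additionally assumes that [2]_g and [3]_g are real and greater than 1; otherwise the bounds are undefined or fail, e.g. for f(z)=z, which always belongs to the class, the right-hand side would be negative when [2]_g<1 or [3]_g<1. *)

theory Defs
  imports "HOL-Complex_Analysis.Complex_Analysis"
begin

abbreviation unit_disc :: "complex set" where
  "unit_disc \<equiv> ball 0 1"

abbreviation taylor_coeff :: "(complex \<Rightarrow> complex) \<Rightarrow> nat \<Rightarrow> complex" where
  "taylor_coeff f n \<equiv> fps_nth (fps_expansion f 0) n"

text \<open>Functions are total in HOL; their values outside the unit disc are irrelevant throughout.\<close>

definition class_A :: "(complex \<Rightarrow> complex) set" where
  "class_A = {f. f holomorphic_on unit_disc \<and> f 0 = 0 \<and> deriv f 0 = 1}"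

definition subordinate :: "(complex \<Rightarrow> complex) \<Rightarrow> (complex \<Rightarrow> complex) \<Rightarrow> bool" where
  "subordinate F \<phi> \<longleftrightarrow>
     F holomorphic_on unit_disc \<and> \<phi> holomorphic_on unit_disc \<and>
     (\<exists>u. u holomorphic_on unit_disc \<and> u 0 = 0 \<and>
          (\<forall>z\<in>unit_disc. cmod (u z) < 1 \<and> F z = \<phi> (u z)))"

text \<open>The factor $1/z$ in $D_g f(z) = \frac{1}{z} (z + \sum_{n \ge 2} [n]_g a_n z^n)$ is
  cancelled termwise, so that the value at the origin is the right one, namely 1; here
  $[n]_g$ is the $n$-th Taylor coefficient of $g$.\<close>

definition g_derivative ::
  "(complex \<Rightarrow> complex) \<Rightarrow> (complex \<Rightarrow> complex) \<Rightarrow> complex \<Rightarrow> complex" where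
  "g_derivative g f z =
     1 + (\<Sum>n. taylor_coeff g (n + 2) * taylor_coeff f (n + 2) * z ^ (n + 1))"

definition admissible_phi :: "(complex \<Rightarrow> complex) \<Rightarrow> bool" where
  "admissible_phi \<phi> \<longleftrightarrow>
     \<phi> holomorphic_on unit_disc \<and>
     (\<forall>z\<in>unit_disc. 0 < Re (\<phi> z)) \<and>
     \<phi> 0 = 1 \<and>
     deriv \<phi> 0 \<in> \<real> \<and> 0 < Re (deriv \<phi> 0) \<and>
     cnj ` \<phi> ` unit_disc = \<phi> ` unit_disc"

text \<open>The quotient $z D_g f(z) / f(z)$ has the form $0/0$ at the origin, where HOL evaluates it
  to 0 although its analytic continuation has the value 1. As the quotient is meant as
  an analytic function on the disc, its removable singularities are removed first.\<close>

definition starlike_class ::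
  "(complex \<Rightarrow> complex) \<Rightarrow> (complex \<Rightarrow> complex) \<Rightarrow> (complex \<Rightarrow> complex) set" where
  "starlike_class g \<phi> =
     {f \<in> class_A. subordinate (remove_sings (\<lambda>z. z * g_derivative g f z / f z)) \<phi>}"

end

theory Submission
  imports Defs
begin

text \<open>
  Write \<open>u\<close> for the function of the subordination, with coefficients \<open>u\<^sub>1, u\<^sub>2, \<dots>\<close>.
  Multiplying the relation \<open>z D\<^sub>g f / f = \<phi> \<circ> u\<close> by \<open>f\<close> turns it into
  an identity of power series: \<open>(\<phi> \<circ> u) \<cdot> f\<close> is the Hadamard product of \<open>g\<close>
  and \<open>f\<close> (\<open>starlike_class_fps_identity\<close>). The coefficients of \<open>z\<^sup>2\<close> and \<open>z\<^sup>3\<close> give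
  \[ (g_2 - 1) a_2 = B_1 u_1, \qquad
     (g_3 - 1) a_3 = B_1 u_1 a_2 + B_1 u_2 + B_2 u_1^2 = B_1 (u_2 + \mu u_1^2), \]
  where the value of \<open>a\<^sub>2\<close> from the first equation has been inserted into the second one, so that
  $\mu = B_2/B_1 + B_1/(g_2-1)$. It remains to bound $|u_1|$ and $|u_2 + \mu u_1^2|$
  for a self-map \<open>u\<close> of the disc that fixes the origin.

  By the Schwarz lemma $|u_1| \le 1$, and \<open>h(z) = u(z)/z\<close> is bounded by 1 on the disc. The
  Schwarz--Pick inequality for \<open>h\<close> at the origin (\<open>Schwarz_Pick_at_0\<close>) reads
  $|u_2| \le 1 - |u_1|^2$. Hence $|u_2 + \mu u_1^2| \le (1 - |u_1|^2) + |u_1|^2\,|\mu|$, where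
  the right-hand side is a convex combination of 1 and $|\mu|$ and so at most their maximum
  (\<open>Schwarz_coefficient_functional\<close>).
\<close>

section \<open>Coefficients of bounded functions\<close>

text \<open>
  The Moebius transformation that sends \<open>h 0\<close> to 0 reduces this to the Schwarz lemma, as long as
  \<open>h\<close> maps into the open disc. If \<open>h\<close> attains the modulus 1, it is constant
  by the maximum modulus principle, and both sides vanish.
\<close>
lemma Schwarz_Pick_at_0:
  assumes hol: "h holomorphic_on ball 0 1"
    and bound: "\<And>z. norm z < 1 \<Longrightarrow> norm (h z) \<le> 1"
  shows "norm (deriv h 0) \<le> 1 - (norm (h 0))\<^sup>2"
proof (cases "\<exists>z. norm z < 1 \<and> norm (h z) = 1")
  case True
  then obtain z where z: "norm z < 1" "norm (h z) = 1"
    by blast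
  have "h constant_on ball 0 1"
    by (rule maximum_modulus_principle[OF hol, where U = "ball 0 1" and \<xi> = z])
      (use z bound in auto)
  then obtain c where c: "\<And>w. w \<in> ball 0 1 \<Longrightarrow> h w = c"
    by (auto simp: constant_on_def)
  have "eventually (\<lambda>w. h w = c) (nhds 0)"
    by (rule eventually_mono[OF eventually_nhds_in_open[of "ball 0 1"]]) (auto simp: c)
  then have "deriv h 0 = 0"
    by (simp add: deriv_cong_ev)
  moreover have "norm (h 0) = 1"
    using c[of 0] c[of z] z by simp
  ultimately show ?thesis
    by simp
next
  case False
  then have lt: "norm (h z) < 1" if "norm z < 1" for z
    using bound[OF that] that by force
  define a where "a = h 0"
  define w where "w z = Moebius_function 0 a (h z)" for z
  have a: "norm a < 1"
    using lt[of 0] by (simp add: a_def)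
  have hol_w: "w holomorphic_on ball 0 1"
    unfolding w_def using lt
    by (intro holomorphic_on_compose_gen[OF hol Moebius_function_holomorphic[OF a], unfolded o_def])
      auto
  have "norm (deriv w 0) \<le> 1"
    by (rule Schwarz_Lemma(2)[OF hol_w, where \<xi> = 0])
      (use lt a in \<open>auto simp: w_def a_def Moebius_function_eq_zero Moebius_function_norm_lt_1\<close>)
  moreover have "deriv w 0 = deriv h 0 / of_real (1 - (norm a)\<^sup>2)"
  proof -
    have aa: "cnj a * a = of_real ((norm a)\<^sup>2)"
      by (metis complex_norm_square mult.commute)
    have pos: "1 - (norm a)\<^sup>2 \<noteq> 0"
      using a abs_square_less_1[of "norm a"] by simp
    have nz: "1 - cnj a * h 0 \<noteq> 0"
      using pos unfolding a_def[symmetric] aa by (metis of_real_1 of_real_diff of_real_eq_0_iff)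
    have dh: "(h has_field_derivative deriv h 0) (at 0)"
      by (rule holomorphic_derivI[OF hol]) auto
    have "(w has_field_derivative
        (deriv h 0 * (1 - cnj a * h 0) - (h 0 - a) * (- (cnj a * deriv h 0)))
          / ((1 - cnj a * h 0) * (1 - cnj a * h 0))) (at 0)"
      unfolding w_def Moebius_function_simple
      by (rule derivative_eq_intros dh refl | use nz in simp)+
    then have "deriv w 0 = deriv h 0 / (1 - cnj a * a)"
      using nz by (auto dest!: DERIV_imp_deriv simp: a_def)
    then show ?thesis
      by (simp add: aa)
  qed
  moreover have "1 - (norm a)\<^sup>2 > 0"
    using a by (simp add: power_less_one_iff abs_square_less_1)
  ultimately show ?thesis
    by (simp add: norm_divide a_def[symmetric] divide_le_eq del: of_real_diff)
qed

text \<open>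
  The coefficients in question are the first two of \<open>h(z) = u(z)/z\<close>, which the Schwarz
  lemma bounds by 1.
\<close>
lemma Schwarz_second_coefficient:
  assumes hol: "u holomorphic_on unit_disc" and zero: "u 0 = 0"
    and bound: "\<And>z. norm z < 1 \<Longrightarrow> norm (u z) < 1"
  shows "norm (taylor_coeff u 1) \<le> 1"
    and "norm (taylor_coeff u 2) \<le> 1 - (norm (taylor_coeff u 1))\<^sup>2"
proof -
  obtain h where hol_h: "h holomorphic_on ball 0 1"
    and u_eq: "\<And>z. norm z < 1 \<Longrightarrow> u z = z * h z" and h0: "deriv u 0 = h 0"
    using Schwarz3[OF hol zero] by blast
  have hb: "norm (h z) \<le> 1" if "norm z < 1" for z
  proof (cases "z = 0")
    case True
    then show ?thesis
      using Schwarz_Lemma(2)[OF hol zero bound that] h0 by simp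
  next
    case False
    then show ?thesis
      using Schwarz_Lemma(1)[OF hol zero bound that] u_eq[OF that] by (simp add: norm_mult)
  qed
  define H where "H = fps_expansion h 0"
  have H: "h has_fps_expansion H"
    unfolding H_def by (rule has_fps_expansion_fps_expansion[OF _ _ hol_h]) auto
  have "u has_fps_expansion fps_X * H"
  proof (subst has_fps_expansion_cong[OF _ refl])
    show "eventually (\<lambda>z. u z = z * h z) (nhds 0)"
      by (rule eventually_mono[OF eventually_nhds_in_open[of "ball 0 1"]]) (auto simp: u_eq)
  qed (intro fps_expansion_intros H)
  moreover have "u has_fps_expansion fps_expansion u 0"
    by (rule has_fps_expansion_fps_expansion[OF _ _ hol]) auto
  ultimately have U: "fps_expansion u 0 = fps_X * H"
    by (rule fps_expansion_unique_complex[symmetric])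
  have "taylor_coeff u 1 = h 0" "taylor_coeff u 2 = deriv h 0"
    unfolding U by (simp_all add: numeral_2_eq_2) (simp_all add: H_def fps_expansion_def)
  then show "norm (taylor_coeff u 1) \<le> 1"
    "norm (taylor_coeff u 2) \<le> 1 - (norm (taylor_coeff u 1))\<^sup>2"
    using hb[of 0] Schwarz_Pick_at_0[OF hol_h hb] by auto
qed

text \<open>
  By the bound on the second coefficient, the left-hand side is at most a convex combination of 1
  and \<open>norm \<mu>\<close>, with weight \<open>t = (norm u\<^sub>1)\<^sup>2\<close> on the latter.
\<close>
lemma Schwarz_coefficient_functional:
  assumes hol: "u holomorphic_on unit_disc" and zero: "u 0 = 0"
    and bound: "\<And>z. norm z < 1 \<Longrightarrow> norm (u z) < 1"
  shows "norm (taylor_coeff u 2 + \<mu> * (taylor_coeff u 1)\<^sup>2) \<le> max 1 (norm \<mu>)"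
proof -
  define t where "t = (norm (taylor_coeff u 1))\<^sup>2"
  have t: "0 \<le> t" "t \<le> 1"
    using Schwarz_second_coefficient(1)[OF hol zero bound]
    by (auto simp: t_def intro: power_le_one)
  have "norm (taylor_coeff u 2 + \<mu> * (taylor_coeff u 1)\<^sup>2)
      \<le> norm (taylor_coeff u 2) + norm \<mu> * t"
    by (rule order.trans[OF norm_triangle_ineq]) (simp add: t_def norm_mult norm_power)
  also have "\<dots> \<le> (1 - t) * 1 + t * norm \<mu>"
    using Schwarz_second_coefficient(2)[OF hol zero bound] by (simp add: t_def)
  also have "\<dots> \<le> (1 - t) * max 1 (norm \<mu>) + t * max 1 (norm \<mu>)"
    using t by (intro add_mono mult_left_mono) auto
  also have "\<dots> = max 1 (norm \<mu>)"
    by (simp add: algebra_simps)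
  finally show ?thesis .
qed

section \<open>The subordination as an identity of power series\<close>

text \<open>
  If both series converge absolutely at \<open>r\<close> and \<open>s\<close> respectively, the terms of the first are
  eventually below 1, so at \<open>r * s\<close> the second series is a majorant of the product. This
  makes the series in the definition of the \<open>g\<close>-derivative the expansion of an analytic function.
\<close>
lemma conv_radius_Hadamard_pos:
  fixes a b :: "nat \<Rightarrow> complex"
  assumes "conv_radius a > 0" "conv_radius b > 0"
  shows "conv_radius (\<lambda>n. a n * b n) > 0"
proof -
  obtain r where r: "0 < ereal r" "ereal r < conv_radius a"
    using ereal_dense2[OF assms(1)] by blast
  obtain s where s: "0 < ereal s" "ereal s < conv_radius b"
    using ereal_dense2[OF assms(2)] by blast
  have sa: "summable (\<lambda>n. norm (a n * of_real r ^ n))"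
    using r by (intro abs_summable_in_conv_radius) auto
  have sb: "summable (\<lambda>n. norm (b n * of_real s ^ n))"
    using s by (intro abs_summable_in_conv_radius) auto
  have "eventually (\<lambda>n. norm (a n * of_real r ^ n) < 1) sequentially"
    using summable_LIMSEQ_zero[OF sa] by (rule order_tendstoD) simp
  then have "eventually (\<lambda>n. norm (a n * b n * of_real (r * s) ^ n)
      \<le> norm (b n * of_real s ^ n)) sequentially"
  proof eventually_elim
    case (elim n)
    have "norm (a n * b n * of_real (r * s) ^ n)
        = norm (a n * of_real r ^ n) * norm (b n * of_real s ^ n)"
      by (simp add: norm_mult power_mult_distrib)
    also have "\<dots> \<le> norm (b n * of_real s ^ n)"
      using elim by (intro mult_left_le_one_le) auto
    finally show ?case .
  qed
  then have "summable (\<lambda>n. a n * b n * of_real (r * s) ^ n)"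
    using sb by (rule summable_comparison_test_ev)
  then have "conv_radius (\<lambda>n. a n * b n) \<ge> norm (of_real (r * s) :: complex)"
    by (rule conv_radius_geI)
  moreover have "0 < ereal (norm (of_real (r * s) :: complex))"
    using r s by simp
  ultimately show ?thesis
    by (rule less_le_trans[rotated])
qed

lemma class_A_expansion:
  assumes "f \<in> class_A"
  shows "f has_fps_expansion fps_expansion f 0" "taylor_coeff f 0 = 0" "taylor_coeff f 1 = 1"
proof -
  show "f has_fps_expansion fps_expansion f 0"
    using assms by (intro has_fps_expansion_fps_expansion[of unit_disc]) (auto simp: class_A_def)
  show "taylor_coeff f 0 = 0" "taylor_coeff f 1 = 1"
    using assms by (auto simp: class_A_def fps_expansion_def)
qed

text \<open>
  The summand 1 outside the series in the definition of the \<open>g\<close>-derivative is the term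
  \<open>g\<^sub>1 a\<^sub>1\<close>, which lets all coefficients follow one formula.
\<close>
lemma g_derivative_expansion:
  assumes g: "g \<in> class_A" and f: "f \<in> class_A"
  shows "g_derivative g f has_fps_expansion Abs_fps (\<lambda>n. taylor_coeff g (Suc n) * taylor_coeff f (Suc n))"
    (is "_ has_fps_expansion ?D")
proof -
  define c where "c n = taylor_coeff g n * taylor_coeff f n" for n
  have "conv_radius c > 0"
    unfolding c_def using class_A_expansion(1)[OF g] class_A_expansion(1)[OF f]
    by (intro conv_radius_Hadamard_pos) (auto simp: has_fps_expansion_def fps_conv_radius_def)
  then have rad: "fps_conv_radius ?D > 0"
    using conv_radius_shift[of c 1] by (simp add: fps_conv_radius_def c_def)
  have ev: "eval_fps ?D z = g_derivative g f z" if "z \<in> eball 0 (fps_conv_radius ?D)" for z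
  proof -
    have "summable (\<lambda>n. fps_nth ?D n * z ^ n)"
      using that by (intro summable_fps) auto
    then have "eval_fps ?D z = fps_nth ?D 0 + (\<Sum>n. fps_nth ?D (Suc n) * z ^ Suc n)"
      unfolding eval_fps_def by (subst suminf_split_head) auto
    then show ?thesis
      using class_A_expansion(3)[OF g] class_A_expansion(3)[OF f]
      by (simp add: g_derivative_def)
  qed
  have "eventually (\<lambda>z. z \<in> eball 0 (fps_conv_radius ?D)) (nhds 0)"
    using rad by (intro eventually_nhds_in_open) (auto simp: zero_ereal_def)
  then have "eventually (\<lambda>z. eval_fps ?D z = g_derivative g f z) (nhds 0)"
    by (rule eventually_mono) (rule ev)
  then show ?thesis
    using rad by (simp add: has_fps_expansion_def)
qed

text \<open>
  Near the origin \<open>f\<close> has a simple zero, and so has \<open>z D\<^sub>g f\<close>; the quotient therefore extends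
  analytically, and its expansion is the quotient of the two power series. It is the expansion of
  \<open>\<phi> \<circ> u\<close> as well, and clearing the denominator leaves the Hadamard product of \<open>g\<close> and \<open>f\<close>.
\<close>
lemma starlike_class_fps_identity:
  assumes g: "g \<in> class_A" and f: "f \<in> starlike_class g \<phi>"
  obtains u where "u holomorphic_on unit_disc" "u 0 = 0"
    "\<And>z. norm z < 1 \<Longrightarrow> norm (u z) < 1"
    "(fps_expansion \<phi> 0 oo fps_expansion u 0) * fps_expansion f 0 =
       Abs_fps (\<lambda>n. taylor_coeff g n * taylor_coeff f n)"
proof -
  define Q where "Q z = z * g_derivative g f z / f z" for z
  define F where "F = fps_expansion f 0"
  define D where "D = Abs_fps (\<lambda>n. taylor_coeff g (Suc n) * taylor_coeff f (Suc n))"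
  have fA: "f \<in> class_A" and sub: "subordinate (remove_sings Q) \<phi>"
    using f by (auto simp: starlike_class_def Q_def[abs_def])
  obtain u where u: "u holomorphic_on unit_disc" "u 0 = 0"
    "\<And>z. norm z < 1 \<Longrightarrow> norm (u z) < 1"
    "\<And>z. norm z < 1 \<Longrightarrow> remove_sings Q z = \<phi> (u z)"
    using sub by (auto simp: subordinate_def)
  have hol_\<phi>: "\<phi> holomorphic_on unit_disc"
    using sub by (simp add: subordinate_def)
  note F = class_A_expansion[OF fA, folded F_def]
  have sF: "subdegree F = 1" and F0: "F \<noteq> 0"
    using F by (auto intro!: subdegreeI)
  have D0: "fps_nth D 0 = 1"
    using class_A_expansion(3)[OF fA] class_A_expansion(3)[OF g] by (simp add: D_def)
  have sXD: "subdegree (fps_X * D) = 1"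
    using D0 by (intro subdegreeI) auto
  \<comment> \<open>The function \<open>q\<close> is \<open>Q\<close> with the value of its continuation at 0; this
    value is the quotient of the leading coefficients of \<open>fps_X * D\<close> and \<open>F\<close>, both of which are 1.\<close>
  define q where "q z = (if z = 0 then 1 else z * g_derivative g f z / f z)" for z
  have q: "q has_fps_expansion (fps_X * D) / F"
    unfolding q_def
    by (rule has_fps_expansion_divide)
      (use F F0 sF sXD D0 in \<open>auto intro!: fps_expansion_intros g_derivative_expansion g fA simp: D_def\<close>)
  \<comment> \<open>Limits at a point ignore the value at that point, so changing \<open>Q\<close> at 0 has no effect.\<close>
  have "remove_sings Q = remove_sings q"
  proof
    fix z :: complex
    have "eventually (\<lambda>w. w \<noteq> 0) (at z)"
      by (rule eventually_neq_at_within)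
    then show "remove_sings Q z = remove_sings q z"
      by (intro remove_sings_cong refl) (auto simp: Q_def q_def elim!: eventually_mono)
  qed
  moreover have "eventually (\<lambda>z. remove_sings q z = q z) (nhds 0)"
    using has_fps_expansion_imp_analytic_0[OF q] by (rule eventually_remove_sings_eq_nhds)
  moreover have "eventually (\<lambda>z. remove_sings Q z = (\<phi> \<circ> u) z) (nhds 0)"
    by (rule eventually_mono[OF eventually_nhds_in_open[of "ball 0 1"]]) (auto simp: u)
  ultimately have "eventually (\<lambda>z. (\<phi> \<circ> u) z = q z) (nhds 0)"
    by (auto elim: eventually_elim2)
  then have "(\<phi> \<circ> u) has_fps_expansion (fps_X * D) / F"
    using q has_fps_expansion_cong by blast
  moreover have "(\<phi> \<circ> u) has_fps_expansion (fps_expansion \<phi> 0 oo fps_expansion u 0)"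
    by (intro has_fps_expansion_compose has_fps_expansion_fps_expansion[of "ball 0 1"] hol_\<phi> u(1))
      (auto simp: fps_expansion_def u)
  ultimately have "(fps_expansion \<phi> 0 oo fps_expansion u 0) = (fps_X * D) / F"
    by (rule fps_expansion_unique_complex[symmetric])
  moreover have "F dvd fps_X * D"
    using sF sXD F0 D0 by (subst fps_dvd_iff) auto
  ultimately have "(fps_expansion \<phi> 0 oo fps_expansion u 0) * F = fps_X * D"
    by simp
  also have "\<dots> = Abs_fps (\<lambda>n. taylor_coeff g n * taylor_coeff f n)"
    using F(2) by (auto simp: fps_eq_iff D_def F_def)
  finally show ?thesis
    using that[OF u(1-3)] by (simp add: F_def)
qed

section \<open>The coefficient bounds\<close>

lemma fps_compose_low_coefficients:
  fixes a b :: "complex fps"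
  assumes "fps_nth b 0 = 0"
  shows "fps_nth (a oo b) 1 = fps_nth a 1 * fps_nth b 1"
    and "fps_nth (a oo b) 2 = fps_nth a 1 * fps_nth b 2 + fps_nth a 2 * (fps_nth b 1)\<^sup>2"
  using assms
  by (simp_all add: fps_compose_nth numeral_2_eq_2 fps_mult_nth power2_eq_square)

theorem theorem2p7:
  fixes f g \<phi> :: "complex \<Rightarrow> complex" and g2 g3 B1 :: real and B2 :: complex
  assumes "g \<in> class_A"
    and "taylor_coeff g 2 = complex_of_real g2" and "1 < g2"
    and "taylor_coeff g 3 = complex_of_real g3" and "1 < g3"
    and "admissible_phi \<phi>"
    and "taylor_coeff \<phi> 1 = complex_of_real B1"
    and "taylor_coeff \<phi> 2 = B2"
    and "f \<in> starlike_class g \<phi>"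
  shows "cmod (taylor_coeff f 2) \<le> B1 / (g2 - 1) \<and>
         cmod (taylor_coeff f 3)
           \<le> B1 / (g3 - 1) *
             max 1 (cmod (B2 / complex_of_real B1 + complex_of_real (B1 / (g2 - 1))))"
proof -
  note g2 = assms(2,3) and g3 = assms(4,5) and B = assms(7,8)
  have \<phi>0: "\<phi> 0 = 1"
    using assms(6) by (simp add: admissible_phi_def)
  have B1: "B1 > 0"
    using assms(6) B(1) by (simp add: admissible_phi_def fps_expansion_def)
  have fA: "f \<in> class_A"
    using assms(9) by (simp add: starlike_class_def)
  note a = class_A_expansion(2,3)[OF fA]
  obtain u where u: "u holomorphic_on unit_disc" "u 0 = 0"
    "\<And>z. norm z < 1 \<Longrightarrow> norm (u z) < 1"
    and id: "(fps_expansion \<phi> 0 oo fps_expansion u 0) * fps_expansion f 0 =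
       Abs_fps (\<lambda>n. taylor_coeff g n * taylor_coeff f n)"
    using starlike_class_fps_identity[OF assms(1,9)] by blast
  define a2 a3 u1 u2 where "a2 = taylor_coeff f 2" and "a3 = taylor_coeff f 3"
    and "u1 = taylor_coeff u 1" and "u2 = taylor_coeff u 2"
  define P where "P = fps_expansion \<phi> 0 oo fps_expansion u 0"
  have u0: "taylor_coeff u 0 = 0"
    using u(2) by (simp add: fps_expansion_def)
  have P: "fps_nth P 0 = 1" "fps_nth P 1 = of_real B1 * u1"
    "fps_nth P 2 = of_real B1 * u2 + B2 * u1\<^sup>2"
    using \<phi>0 B fps_compose_low_coefficients[OF u0]
    by (simp_all add: P_def u1_def u2_def fps_expansion_def)
  have "fps_nth (P * fps_expansion f 0) 2 = of_real g2 * a2"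
    using id g2 by (simp add: P_def a2_def)
  moreover have "fps_nth (P * fps_expansion f 0) 2 = a2 + of_real B1 * u1"
    using a P by (simp add: fps_mult_nth numeral_2_eq_2 a2_def)
  ultimately have eq2: "of_real (g2 - 1) * a2 = of_real B1 * u1"
    by (simp add: algebra_simps)
  have "fps_nth (P * fps_expansion f 0) 3 = of_real g3 * a3"
    using id g3 by (simp add: P_def a3_def)
  moreover have "fps_nth (P * fps_expansion f 0) 3
      = a3 + of_real B1 * u1 * a2 + (of_real B1 * u2 + B2 * u1\<^sup>2)"
    using a P by (simp add: fps_mult_nth numeral_2_eq_2 numeral_3_eq_3 a2_def a3_def)
  ultimately have eq3: "of_real (g3 - 1) * a3
      = of_real B1 * u1 * a2 + of_real B1 * u2 + B2 * u1\<^sup>2"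
    by (simp add: algebra_simps)
  define \<mu> where "\<mu> = B2 / of_real B1 + complex_of_real (B1 / (g2 - 1))"
  have nz: "complex_of_real (g2 - 1) \<noteq> 0" "complex_of_real B1 \<noteq> 0"
    using g2(2) B1 by (simp_all del: of_real_diff)
  have a2_eq: "a2 = of_real B1 * u1 / of_real (g2 - 1)"
    using eq2 nz(1) by (metis nonzero_mult_div_cancel_left)
  have eq3': "of_real (g3 - 1) * a3 = of_real B1 * (u2 + \<mu> * u1\<^sup>2)"
    unfolding eq3 a2_eq \<mu>_def using nz
    by (simp add: field_simps power2_eq_square del: of_real_diff)
  have "(g2 - 1) * norm a2 = B1 * norm u1"
    using arg_cong[OF eq2, of norm] g2(2) B1 by (simp add: norm_mult del: of_real_diff)
  moreover have "norm u1 \<le> 1"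
    using Schwarz_second_coefficient(1)[OF u(1-3)] by (simp add: u1_def)
  ultimately have "(g2 - 1) * norm a2 \<le> B1"
    using B1 by (simp add: mult_left_le)
  then have "norm a2 \<le> B1 / (g2 - 1)"
    using g2(2) by (simp add: field_simps)
  moreover have "(g3 - 1) * norm a3 = B1 * norm (u2 + \<mu> * u1\<^sup>2)"
    using arg_cong[OF eq3', of norm] g3(2) B1 by (simp add: norm_mult del: of_real_diff)
  then have "(g3 - 1) * norm a3 \<le> B1 * max 1 (norm \<mu>)"
    using B1 Schwarz_coefficient_functional[OF u(1-3), of \<mu>]
    by (simp add: u1_def u2_def mult_left_mono)
  then have "norm a3 \<le> B1 / (g3 - 1) * max 1 (norm \<mu>)"
    using g3(2) by (simp add: field_simps)
  ultimately show ?thesis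
    by (simp add: a2_def a3_def \<mu>_def)
qed

end
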